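(* A Minkowski plane $(M,\|\cdot\|)$ is Euclidean if and only if for any $\mathcal{C}$-orthocentric system $\{p_1,p_2,p_3,p_4\}$ (with $p_3\neq\frac{p_1+p_2}{2}$, so that the line below is defined), the equality $\|p_3-p_1\|=\|p_3-p_2\|$ holds whenever $p_4\in\left\langle p_3,\frac{p_1+p_2}{2}\right\rangle$.
   Context: A Minkowski plane is a real two-dimensional normed linear space; it is Euclidean if its norm is induced by an inner product. For $x\ne y$, $\langle x,y\rangle$ denotes the line through $x$ and $y$. $S_p(w)=2p-w$ is the symmetry with center $p$. For points $a,b,c\in M$, the set of circumcenters is $\mathcal{C}(\triangle abc)=\{x\in M:\|x-a\|=\|x-b\|=\|x-c\|\}$. $\mathcal{C}$-orthocenter: given points $a,b,c\in M$ and $o\in\mathcal{C}(\triangle abc)$, put $q=\frac{a+b+c-o}{2}$, which is the point of symmetry between $\triangle abc$ and the triangle whose vertices are the images of $o$ under the symmetries at the midpoints of the sides $[b,c],[a,c],[a,b]$. The $\mathcal{C}$-orthocenter of $\triangle abc$ associated with $o$ is $S_q(o)=a+b+c-2o$. $\mathcal{C}$-orthocentric system: four points $p_1,p_2,p_3,p_4\in M$ form a $\mathcal{C}$-orthocentric system $\{p_1,p_2,p_3,p_4\}$ if for some labeling $\{i,j,k,l\}=\{1,2,3,4\}$ there is a circumcenter $x_i\in\mathcal{C}(\triangle p_jp_kp_l)$ such that $p_i$ is the $\mathcal{C}$-orthocenter of $\triangle p_jp_kp_l$ associated with $x_i$.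
   Formalization: The four points of a C-orthocentric system are required to be pairwise distinct; otherwise a non-isosceles Euclidean right triangle with right angle at p3, where p4 = p3, would contradict the claimed equality. *)

theory Defs
  imports "HOL-Analysis.Analysis"
begin

text \<open>
  A Minkowski plane is a type of class \<^class>\<open>real_normed_vector\<close> whose universe has
  \<^const>\<open>dim\<close> equal to 2. As \<^const>\<open>dim\<close> is 0 for infinite-dimensional spaces, this
  equation includes finite-dimensionality.
\<close>

definition minkowski_plane :: "'a::real_normed_vector itself \<Rightarrow> bool"
  where "minkowski_plane _ \<longleftrightarrow> dim (UNIV :: 'a set) = 2"

definition inner_product_form :: "('a::real_vector \<Rightarrow> 'a \<Rightarrow> real) \<Rightarrow> bool"
  where "inner_product_form B \<longleftrightarrow>
    bilinear B \<and> (\<forall>x y. B x y = B y x) \<and> (\<forall>x. x \<noteq> 0 \<longrightarrow> B x x > 0)"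

definition euclidean_norm :: "'a::real_normed_vector itself \<Rightarrow> bool"
  where "euclidean_norm _ \<longleftrightarrow>
    (\<exists>B :: 'a \<Rightarrow> 'a \<Rightarrow> real. inner_product_form B \<and> (\<forall>x. norm x = sqrt (B x x)))"

definition point_symmetry :: "'a::real_vector \<Rightarrow> 'a \<Rightarrow> 'a"
  where "point_symmetry p w = 2 *\<^sub>R p - w"

definition circumcenters :: "'a::real_normed_vector \<Rightarrow> 'a \<Rightarrow> 'a \<Rightarrow> 'a set"
  where "circumcenters a b c = {x. norm (x - a) = norm (x - b) \<and> norm (x - b) = norm (x - c)}"

definition symmetry_center :: "'a::real_vector \<Rightarrow> 'a \<Rightarrow> 'a \<Rightarrow> 'a \<Rightarrow> 'a"
  where "symmetry_center a b c z = (1/2) *\<^sub>R (a + b + c - z)"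

definition C_orthocenter :: "'a::real_vector \<Rightarrow> 'a \<Rightarrow> 'a \<Rightarrow> 'a \<Rightarrow> 'a"
  where "C_orthocenter a b c z = point_symmetry (symmetry_center a b c z) z"

lemma symmetry_center_vertices:
  "point_symmetry (symmetry_center a b c z) a = point_symmetry (midpoint b c) z"
  "point_symmetry (symmetry_center a b c z) b = point_symmetry (midpoint a c) z"
  "point_symmetry (symmetry_center a b c z) c = point_symmetry (midpoint a b) z"
  by (simp_all add: point_symmetry_def symmetry_center_def midpoint_def)

lemma C_orthocenter_eq: "C_orthocenter a b c z = a + b + c - 2 *\<^sub>R z"
  by (simp add: C_orthocenter_def point_symmetry_def symmetry_center_def scaleR_2)

text \<open>
  The condition \<^term>\<open>card P = 4\<close> says that the four points are pairwise distinct. It cannot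
  be dropped: if \<^term>\<open>c\<close> is the vertex of a non-isosceles Euclidean right triangle at its right
  angle, the associated orthocenter is \<^term>\<open>c\<close> itself, so it lies on every line
  through \<^term>\<open>c\<close>. The existential choice of \<^term>\<open>a\<close>, \<^term>\<open>b\<close>, \<^term>\<open>c\<close>,
  \<^term>\<open>d\<close> is the choice of a labeling.
\<close>

definition C_orthocentric_system :: "'a::real_normed_vector set \<Rightarrow> bool"
  where "C_orthocentric_system P \<longleftrightarrow> card P = 4 \<and>
    (\<exists>a b c d. P = {a, b, c, d} \<and> (\<exists>x \<in> circumcenters a b c. d = C_orthocenter a b c x))"

end

theory Submission
  imports Defs
begin

text \<open>
  Call \<open>u\<close>, \<open>v\<close> isosceles orthogonal if \<open>\<parallel>u + v\<parallel> = \<parallel>u - v\<parallel>\<close>, that is, if \<open>u + v\<close>, \<open>u - v\<close> lie on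
  a circle around \<open>0\<close> of some radius \<open>R\<close>. Together with \<open>c = -(R / \<parallel>u\<parallel>) u\<close> and the orthocenter
  \<open>2 u + c\<close> associated with \<open>0\<close> they form an orthocentric system to which the condition of the
  theorem applies, so that \<open>(1 + R / \<parallel>u\<parallel>) u\<close> is again isosceles orthogonal to \<open>v\<close>. Iteration yields
  isosceles orthogonality to \<open>v\<close> of arbitrarily large multiples of \<open>u\<close>, which forces Birkhoff
  orthogonality: \<open>u\<close> has minimal norm on the line through \<open>u\<close> in direction \<open>v\<close>. Hence the midpoint
  of a chord of a circle is a point of its line that is nearest to the center. This excludes segments
  in the unit circle, so the nearest point is unique, and therefore all multiples of \<open>u\<close> are
  isosceles orthogonal to \<open>v\<close>. This means that any two vectors of equal norm are swapped by a linear
  isometry of the plane they span (Ficken's condition), from which the norm is computed in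
  coordinates.
\<close>

section \<open>Isosceles and Birkhoff orthogonality\<close>

definition isosceles_orthogonal :: "'a::real_normed_vector \<Rightarrow> 'a \<Rightarrow> bool"
  where "isosceles_orthogonal u v \<longleftrightarrow> norm (u + v) = norm (u - v)"

definition birkhoff_orthogonal :: "'a::real_normed_vector \<Rightarrow> 'a \<Rightarrow> bool"
  where "birkhoff_orthogonal u v \<longleftrightarrow> (\<forall>t. norm u \<le> norm (u + t *\<^sub>R v))"

lemma isosceles_orthogonal_zero [simp]:
  "isosceles_orthogonal 0 v" "isosceles_orthogonal u 0"
  by (simp_all add: isosceles_orthogonal_def)

lemma isosceles_orthogonal_minus_right:
  "isosceles_orthogonal u (- v) \<longleftrightarrow> isosceles_orthogonal u v"
  by (auto simp: isosceles_orthogonal_def)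

lemma isosceles_orthogonal_scaleR:
  assumes "isosceles_orthogonal u v"
  shows "isosceles_orthogonal (c *\<^sub>R u) (c *\<^sub>R v)"
  using assms by (simp add: isosceles_orthogonal_def flip: scaleR_add_right scaleR_diff_right)

lemma isosceles_orthogonal_sum_diff:
  "norm x = norm y \<Longrightarrow> isosceles_orthogonal (x + y) (x - y)"
  by (simp add: isosceles_orthogonal_def flip: scaleR_2)

text \<open>\<open>u\<close> is the midpoint of \<open>u + v\<close> and \<open>u - v\<close>, which
  lie on one circle around \<open>0\<close>.\<close>

lemma isosceles_orthogonal_norm_le:
  assumes "isosceles_orthogonal u v"
  shows "norm u \<le> norm (u + v)"
proof -
  have "norm (2 *\<^sub>R u) = norm ((u + v) + (u - v))"
    by (simp add: scaleR_2)
  also have "\<dots> \<le> norm (u + v) + norm (u - v)"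
    by (rule norm_triangle_ineq)
  finally show ?thesis
    using assms by (simp add: isosceles_orthogonal_def)
qed

lemma isosceles_orthogonal_not_parallel:
  assumes "isosceles_orthogonal u v" "u \<noteq> 0" "v \<noteq> 0"
  shows "v \<noteq> k *\<^sub>R u"
proof
  assume v: "v = k *\<^sub>R u"
  have "u + v = (1 + k) *\<^sub>R u" "u - v = (1 - k) *\<^sub>R u"
    by (simp_all add: v algebra_simps)
  with assms(1,2) have "\<bar>1 + k\<bar> = \<bar>1 - k\<bar>"
    by (simp add: isosceles_orthogonal_def)
  then have "k = 0"
    by linarith
  with v assms(3) show False
    by simp
qed

lemma birkhoff_orthogonal_minus_right:
  "birkhoff_orthogonal u (- v) \<longleftrightarrow> birkhoff_orthogonal u v"
proof -
  have "birkhoff_orthogonal u (- v)" if "birkhoff_orthogonal u v" for v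
    unfolding birkhoff_orthogonal_def
  proof
    fix t
    show "norm u \<le> norm (u + t *\<^sub>R (- v))"
      using that[unfolded birkhoff_orthogonal_def, rule_format, of "- t"] by simp
  qed
  from this[of v] this[of "- v"] show ?thesis
    by auto
qed

lemma birkhoff_orthogonal_scaleR_left:
  assumes "birkhoff_orthogonal u v"
  shows "birkhoff_orthogonal (c *\<^sub>R u) v"
  unfolding birkhoff_orthogonal_def
proof
  fix t
  show "norm (c *\<^sub>R u) \<le> norm (c *\<^sub>R u + t *\<^sub>R v)"
  proof (cases "c = 0")
    case False
    have "norm (c *\<^sub>R u) \<le> \<bar>c\<bar> * norm (u + (t / c) *\<^sub>R v)"
      using assms by (simp add: birkhoff_orthogonal_def mult_left_mono)
    also have "\<dots> = norm (c *\<^sub>R (u + (t / c) *\<^sub>R v))"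
      by simp
    also have "c *\<^sub>R (u + (t / c) *\<^sub>R v) = c *\<^sub>R u + t *\<^sub>R v"
      using False by (simp add: scaleR_add_right)
    finally show ?thesis .
  qed simp
qed

lemma birkhoff_orthogonal_scaleR_right:
  assumes "birkhoff_orthogonal u (c *\<^sub>R v)" "c \<noteq> 0"
  shows "birkhoff_orthogonal u v"
  unfolding birkhoff_orthogonal_def
proof
  fix t
  show "norm u \<le> norm (u + t *\<^sub>R v)"
    using assms(1)[unfolded birkhoff_orthogonal_def, rule_format, of "t / c"] assms(2) by simp
qed

section \<open>From isosceles to Birkhoff orthogonality\<close>

text \<open>
  If \<open>\<parallel>u + t v\<parallel> < \<parallel>u\<parallel>\<close>, then by convexity \<open>\<parallel>\<beta> u + v\<parallel> - \<beta> \<parallel>u\<parallel>\<close> stays below a negative constant for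
  large \<open>\<beta>\<close>, while \<open>\<parallel>\<beta> u + v\<parallel> + \<parallel>\<beta> u - v\<parallel> \<ge> 2 \<beta> \<parallel>u\<parallel>\<close>.
\<close>

lemma birkhoff_orthogonal_if_large_multiples:
  assumes large: "\<And>K. \<exists>\<beta>\<ge>K. isosceles_orthogonal (\<beta> *\<^sub>R u) v"
  shows "birkhoff_orthogonal u v"
proof -
  have *: "norm u \<le> norm (u + t *\<^sub>R w)"
    if "t > 0" and iso: "\<And>K. \<exists>\<beta>\<ge>K. isosceles_orthogonal (\<beta> *\<^sub>R u) w" for t w
  proof -
    obtain \<beta> where \<beta>: "\<beta> \<ge> 1 / t" "isosceles_orthogonal (\<beta> *\<^sub>R u) w"
      using iso by blast
    have "0 < 1 / t"
      using \<open>t > 0\<close> by simp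
    with \<beta>(1) have "\<beta> > 0"
      by linarith
    have "\<beta> * norm u \<le> norm (\<beta> *\<^sub>R u + w)"
      using isosceles_orthogonal_norm_le[OF \<beta>(2)] \<open>\<beta> > 0\<close> by simp
    also have "\<beta> *\<^sub>R u + w = (\<beta> - 1 / t) *\<^sub>R u + (1 / t) *\<^sub>R (u + t *\<^sub>R w)"
      using \<open>t > 0\<close> by (simp add: algebra_simps)
    also have "norm \<dots> \<le> (\<beta> - 1 / t) * norm u + (1 / t) * norm (u + t *\<^sub>R w)"
      using norm_triangle_ineq[of "(\<beta> - 1 / t) *\<^sub>R u" "(1 / t) *\<^sub>R (u + t *\<^sub>R w)"] \<beta>(1) \<open>t > 0\<close>
      by simp
    finally have "(1 / t) * norm u \<le> (1 / t) * norm (u + t *\<^sub>R w)"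
      by (simp add: left_diff_distrib)
    then show ?thesis
      using \<open>t > 0\<close> by (simp add: divide_right_mono field_simps)
  qed
  show ?thesis
    unfolding birkhoff_orthogonal_def
  proof
    fix t :: real
    consider "t > 0" | "t = 0" | "- t > 0"
      by linarith
    then show "norm u \<le> norm (u + t *\<^sub>R v)"
    proof cases
      case 1
      then show ?thesis
        using *[OF _ large] by blast
    next
      case 3
      then show ?thesis
        using *[of "- t" "- v"] large by (simp add: isosceles_orthogonal_minus_right)
    qed simp
  qed
qed

text \<open>Each use of \<open>step\<close> at least doubles the coefficient, since the factor is
  \<open>1 + \<rho>\<close> and \<open>\<rho> \<ge> 1\<close> by
  \<open>isosceles_orthogonal_norm_le\<close>.\<close>

lemma iterated_isosceles_orthogonal:
  assumes step: "\<And>u v :: 'a::real_normed_vector. isosceles_orthogonal u v \<Longrightarrow> u \<noteq> 0 \<Longrightarrow>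
      isosceles_orthogonal ((1 + norm (u + v) / norm u) *\<^sub>R u) v"
    and iso: "isosceles_orthogonal (u :: 'a) v" and "u \<noteq> 0"
  shows "\<exists>\<beta>\<ge>2 ^ n. isosceles_orthogonal (\<beta> *\<^sub>R u) v"
proof (induction n)
  case 0
  show ?case
    using iso by (intro exI[of _ 1]) simp
next
  case (Suc n)
  then obtain \<beta> where \<beta>: "\<beta> \<ge> 2 ^ n" "isosceles_orthogonal (\<beta> *\<^sub>R u) v"
    by blast
  have "\<beta> > 0"
    using \<beta>(1) zero_less_power[of "2::real" n] by linarith
  define \<rho> where "\<rho> = norm (\<beta> *\<^sub>R u + v) / norm (\<beta> *\<^sub>R u)"
  have "norm (\<beta> *\<^sub>R u) > 0"
    using \<open>\<beta> > 0\<close> \<open>u \<noteq> 0\<close> by simp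
  then have "\<rho> \<ge> 1"
    unfolding \<rho>_def using isosceles_orthogonal_norm_le[OF \<beta>(2)] by (subst le_divide_eq_1_pos)
  have "isosceles_orthogonal ((1 + \<rho>) *\<^sub>R (\<beta> *\<^sub>R u)) v"
    unfolding \<rho>_def using \<open>\<beta> > 0\<close> \<open>u \<noteq> 0\<close> by (intro step[OF \<beta>(2)]) simp
  moreover have "2 ^ Suc n \<le> (1 + \<rho>) * \<beta>"
    using mult_mono[of 2 "1 + \<rho>" "2 ^ n" \<beta>] \<beta>(1) \<open>\<rho> \<ge> 1\<close> by simp
  ultimately show ?case
    by (intro exI[of _ "(1 + \<rho>) * \<beta>"]) simp
qed

lemma isosceles_imp_birkhoff_orthogonal:
  assumes step: "\<And>u v :: 'a::real_normed_vector. isosceles_orthogonal u v \<Longrightarrow> u \<noteq> 0 \<Longrightarrow>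
      isosceles_orthogonal ((1 + norm (u + v) / norm u) *\<^sub>R u) v"
    and iso: "isosceles_orthogonal (u :: 'a) v"
  shows "birkhoff_orthogonal u v"
proof (cases "u = 0")
  case True
  then show ?thesis
    by (simp add: birkhoff_orthogonal_def)
next
  case False
  show ?thesis
  proof (rule birkhoff_orthogonal_if_large_multiples)
    fix K :: real
    obtain n where "K < 2 ^ n"
      using real_arch_pow[of 2 K] by auto
    with iterated_isosceles_orthogonal[OF step iso False, of n]
    show "\<exists>\<beta>\<ge>K. isosceles_orthogonal (\<beta> *\<^sub>R u) v"
      by (meson less_eq_real_def order_trans)
  qed
qed

section \<open>Uniqueness of nearest points and the converse implication\<close>

text \<open>
  Here \<open>[a - v, a]\<close> is a segment of a circle that does not extend to \<open>a + v\<close>. The chord from \<open>a - v\<close>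
  to the projection of \<open>a + v\<close> to the circle has its midpoint in the cone over the segment. The norm
  is linear on this cone and not constant along the chord.
\<close>

lemma no_segment_in_circle:
  assumes IB: "\<And>u v :: 'a::real_normed_vector. isosceles_orthogonal u v \<Longrightarrow> birkhoff_orthogonal u v"
    and min: "birkhoff_orthogonal (a :: 'a) v" and "norm (a - v) = norm a"
  shows "norm (a + v) = norm a"
proof (rule ccontr)
  assume ne: "norm (a + v) \<noteq> norm a"
  define m where "m = norm a"
  have ge: "m \<le> norm (a + t *\<^sub>R v)" for t
    using min by (simp add: birkhoff_orthogonal_def m_def)
  have gt: "m < norm (a + v)"
    using ge[of 1] ne by (simp add: m_def)
  have "m > 0"
  proof (rule ccontr)
    assume "\<not> m > 0"
    then have "a = 0" "a - v = 0"
      using assms(3) by (simp_all add: m_def)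
    with ne show False
      by simp
  qed
  \<comment> \<open>The upper bound is the triangle inequality, the lower bound the minimality of
    \<open>a\<close> on its line in direction \<open>v\<close>.\<close>
  have cone: "norm (h *\<^sub>R a - c *\<^sub>R v) = h * m" if "0 < h" "0 \<le> c" "c \<le> h" for h c
  proof (rule antisym)
    have "h *\<^sub>R a - c *\<^sub>R v = (h - c) *\<^sub>R a + c *\<^sub>R (a - v)"
      by (simp add: algebra_simps)
    also have "norm \<dots> \<le> (h - c) * norm a + c * norm (a - v)"
      using norm_triangle_ineq[of "(h - c) *\<^sub>R a" "c *\<^sub>R (a - v)"] that by simp
    finally show "norm (h *\<^sub>R a - c *\<^sub>R v) \<le> h * m"
      using assms(3) by (simp add: m_def algebra_simps)
    have "h * m \<le> h * norm (a + (- c / h) *\<^sub>R v)"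
      using ge[of "- c / h"] that by (intro mult_left_mono) auto
    also have "\<dots> = norm (h *\<^sub>R (a + (- c / h) *\<^sub>R v))"
      using that by simp
    also have "h *\<^sub>R (a + (- c / h) *\<^sub>R v) = h *\<^sub>R a - c *\<^sub>R v"
      using that by (simp add: algebra_simps)
    finally show "h * m \<le> norm (h *\<^sub>R a - c *\<^sub>R v)" .
  qed
  define l where "l = m / norm (a + v)"
  have "0 < norm (a + v)"
    using gt \<open>m > 0\<close> by linarith
  then have l: "0 < l" "l < 1"
    using gt \<open>m > 0\<close> by (simp_all add: l_def divide_less_eq_1_pos del: zero_less_norm_iff)
  define x where "x = a - v"
  define y where "y = l *\<^sub>R (a + v)"
  have "norm x = norm y"
    using assms(3) \<open>0 < norm (a + v)\<close> by (simp add: x_def y_def l_def m_def)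
  then have B: "birkhoff_orthogonal (x + y) (x - y)"
    by (intro IB isosceles_orthogonal_sum_diff)
  \<comment> \<open>This \<open>\<tau>\<close> halves the coefficient of \<open>v\<close> in
    \<open>x + y\<close>. The moved point stays in the cone while its coefficient of
    \<open>a\<close> drops, so its norm is smaller than that of \<open>x + y\<close>, against
    \<open>B\<close>.\<close>
  define \<tau> where "\<tau> = (1 - l) / (1 + l) / 2"
  have \<tau>: "\<tau> * (1 + l) = (1 - l) / 2" "\<tau> > 0" "\<tau> \<le> 1"
    using l by (auto simp: \<tau>_def field_simps)
  have "x + y = (1 + l) *\<^sub>R a - (1 - l) *\<^sub>R v"
    by (simp add: x_def y_def algebra_simps)
  then have 1: "norm (x + y) = (1 + l) * m"
    using cone[of "1 + l" "1 - l"] l by simp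
  have "x + y + (- \<tau>) *\<^sub>R (x - y)
      = (1 + l - \<tau> * (1 - l)) *\<^sub>R a - (1 - l - \<tau> * (1 + l)) *\<^sub>R v"
    by (simp add: x_def y_def algebra_simps)
  moreover have "\<tau> * (1 - l) \<le> \<tau> * (1 + l)" "\<tau> * (1 - l) > 0"
    using \<tau>(2) l by (auto intro: mult_left_mono)
  moreover from this(1) have "0 < 1 + l - \<tau> * (1 - l)" "1 - l - \<tau> * (1 + l) \<le> 1 + l - \<tau> * (1 - l)"
    "0 \<le> 1 - l - \<tau> * (1 + l)"
    using l unfolding \<tau>(1) by argo+
  ultimately have 2: "norm (x + y + (- \<tau>) *\<^sub>R (x - y)) = (1 + l - \<tau> * (1 - l)) * m"
    using cone[of "1 + l - \<tau> * (1 - l)" "1 - l - \<tau> * (1 + l)"] by simp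
  have "(1 + l) * m \<le> (1 + l - \<tau> * (1 - l)) * m"
    using B[unfolded birkhoff_orthogonal_def, rule_format, of "- \<tau>"] unfolding 1 2 .
  with \<open>m > 0\<close> \<open>\<tau> * (1 - l) > 0\<close> show False
    by simp
qed

text \<open>By \<open>no_segment_in_circle\<close> a step by \<open>v\<close> along the circle can
  be repeated forever, because each point reached is again nearest on the same line. But a circle is
  bounded.\<close>

lemma unique_nearest_point:
  assumes IB: "\<And>u v :: 'a::real_normed_vector. isosceles_orthogonal u v \<Longrightarrow> birkhoff_orthogonal u v"
    and min: "birkhoff_orthogonal (a :: 'a) v" and "norm (a - v) = norm a"
  shows "v = 0"
proof (rule ccontr)
  assume "v \<noteq> 0"
  have *: "norm (a + real n *\<^sub>R v) = norm a \<and> norm (a + (real n - 1) *\<^sub>R v) = norm a" for n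
  proof (induction n)
    case 0
    then show ?case
      using assms(3) by simp
  next
    case (Suc n)
    let ?b = "a + real n *\<^sub>R v"
    have "birkhoff_orthogonal ?b v"
      unfolding birkhoff_orthogonal_def
    proof
      fix t
      have "norm a \<le> norm (a + (real n + t) *\<^sub>R v)"
        using min by (simp add: birkhoff_orthogonal_def)
      then show "norm ?b \<le> norm (?b + t *\<^sub>R v)"
        using Suc by (simp add: algebra_simps)
    qed
    moreover have "norm (?b - v) = norm ?b"
      using Suc by (simp add: algebra_simps)
    ultimately have "norm (?b + v) = norm ?b"
      by (intro no_segment_in_circle[OF IB])
    then show ?case
      using Suc by (simp add: algebra_simps)
  qed
  obtain n where n: "2 * norm a < real n * norm v"
    using reals_Archimedean3[of "norm v"] \<open>v \<noteq> 0\<close> by auto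
  have "real n * norm v = norm ((a + real n *\<^sub>R v) - a)"
    by simp
  also have "\<dots> \<le> norm (a + real n *\<^sub>R v) + norm a"
    by (rule norm_triangle_ineq4)
  finally show False
    using n *[of n] by simp
qed

text \<open>The intermediate value theorem gives a chord from \<open>u + v\<close> to
  \<open>u - s v\<close> of a circle around \<open>0\<close>. Its midpoint is nearest to
  \<open>0\<close> on the line by \<open>IB\<close>, and so is \<open>u\<close>. By uniqueness they
  agree, so \<open>s = 1\<close>.\<close>

lemma birkhoff_imp_isosceles_orthogonal:
  assumes IB: "\<And>u v :: 'a::real_normed_vector. isosceles_orthogonal u v \<Longrightarrow> birkhoff_orthogonal u v"
    and "birkhoff_orthogonal (u :: 'a) v"
  shows "isosceles_orthogonal u v"
proof -
  have *: "isosceles_orthogonal u v"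
    if B: "birkhoff_orthogonal u v" and le: "norm (u + v) \<le> norm (u - v)" for v :: 'a
  proof -
    have "norm u \<le> norm (u + v)"
      using B[unfolded birkhoff_orthogonal_def, rule_format, of 1] by simp
    with le have "\<exists>s\<ge>0. s \<le> 1 \<and> norm (u - s *\<^sub>R v) = norm (u + v)"
      by (intro IVT') (auto intro!: continuous_intros)
    then obtain s where s: "0 \<le> s" "s \<le> 1" "norm (u - s *\<^sub>R v) = norm (u + v)"
      by blast
    define r where "r = (1 - s) / 2"
    let ?w = "u + r *\<^sub>R v"
    have eq: "?w + (1 - r) *\<^sub>R v = u + v" "?w - (1 - r) *\<^sub>R v = u - s *\<^sub>R v"
      by (simp_all add: algebra_simps r_def flip: scaleR_add_left)
    have "isosceles_orthogonal ?w ((1 - r) *\<^sub>R v)"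
      unfolding isosceles_orthogonal_def eq using s(3) by simp
    then have "birkhoff_orthogonal ?w ((1 - r) *\<^sub>R v)"
      by (rule IB)
    then have Bw: "birkhoff_orthogonal ?w v"
      by (rule birkhoff_orthogonal_scaleR_right) (use s in \<open>simp add: r_def\<close>)
    have "norm ?w \<le> norm (?w + (- r) *\<^sub>R v)" "norm u \<le> norm (u + r *\<^sub>R v)"
      using Bw B unfolding birkhoff_orthogonal_def by blast+
    then have "norm (?w - r *\<^sub>R v) = norm ?w"
      by simp
    moreover have "birkhoff_orthogonal ?w (r *\<^sub>R v)"
      using Bw by (simp add: birkhoff_orthogonal_def)
    ultimately have "r *\<^sub>R v = 0"
      using unique_nearest_point[OF IB, of ?w "r *\<^sub>R v"] by blast
    then show ?thesis
      using s(3) by (auto simp: r_def isosceles_orthogonal_def)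
  qed
  show ?thesis
    using *[of v] *[of "- v"] assms(2)
    by (cases "norm (u + v) \<le> norm (u - v)")
      (simp_all add: birkhoff_orthogonal_minus_right isosceles_orthogonal_minus_right)
qed

text \<open>Birkhoff orthogonality is homogeneous in \<open>u\<close>, so a detour through it scales
  \<open>u\<close> by \<open>c / d\<close>; scaling both vectors by \<open>d\<close> then gives the
  claim.\<close>

lemma isosceles_orthogonal_scale_both:
  assumes IB: "\<And>u v :: 'a::real_normed_vector. isosceles_orthogonal u v \<Longrightarrow> birkhoff_orthogonal u v"
    and "isosceles_orthogonal (u :: 'a) v"
  shows "isosceles_orthogonal (c *\<^sub>R u) (d *\<^sub>R v)"
proof (cases "d = 0")
  case False
  have "isosceles_orthogonal ((c / d) *\<^sub>R u) v"
    using IB birkhoff_orthogonal_scaleR_left[OF IB[OF assms(2)]] by (rule birkhoff_imp_isosceles_orthogonal)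
  from isosceles_orthogonal_scaleR[OF this, of d] show ?thesis
    using False by simp
qed simp

section \<open>Ficken's condition and the inner product in coordinates\<close>

lemma ficken_condition:
  assumes iso: "\<And>(u :: 'a::real_normed_vector) v c d. isosceles_orthogonal u v \<Longrightarrow>
      isosceles_orthogonal (c *\<^sub>R u) (d *\<^sub>R v)"
    and "norm (x :: 'a) = norm y"
  shows "norm (\<alpha> *\<^sub>R x + \<beta> *\<^sub>R y) = norm (\<beta> *\<^sub>R x + \<alpha> *\<^sub>R y)"
proof -
  \<comment> \<open>Coefficients with respect to \<open>x + y\<close> and \<open>x - y\<close>:
    exchanging \<open>\<alpha>\<close> and \<open>\<beta>\<close> only flips the sign of
    \<open>d\<close>.\<close>
  define c where "c = (\<alpha> + \<beta>) / 2"
  define d where "d = (\<alpha> - \<beta>) / 2"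
  have eq: "\<alpha> = c + d" "\<beta> = c - d"
    by (simp_all add: c_def d_def field_simps)
  have "\<alpha> *\<^sub>R x + \<beta> *\<^sub>R y = c *\<^sub>R (x + y) + d *\<^sub>R (x - y)"
    "\<beta> *\<^sub>R x + \<alpha> *\<^sub>R y = c *\<^sub>R (x + y) - d *\<^sub>R (x - y)"
    unfolding eq by (simp_all add: algebra_simps)
  with iso[OF isosceles_orthogonal_sum_diff[OF assms(2)]] show ?thesis
    by (simp add: isosceles_orthogonal_def)
qed

text \<open>
  Let \<open>T\<close> be the isometry swapping \<open>e1\<close> and the unit vector \<open>z = p e1 + q e2\<close>. As the norm has the
  symmetries of the square in the basis \<open>e1\<close>, \<open>e2\<close>, the transpose of \<open>T\<close> is an isometry as
  well. The first coordinate of its value at \<open>z\<close> is \<open>p\<^sup>2 + q\<^sup>2\<close>, and coordinates of unit vectors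
  are at most \<open>1\<close>. Applied to \<open>z\<close> and to the value \<open>p e1 + k e2\<close> at \<open>e1\<close>, where \<open>p\<^sup>2 + k q = 1\<close>,
  this yields \<open>k = q\<close>.
\<close>

lemma unit_circle_coordinates:
  fixes e1 e2 :: "'a::real_normed_vector"
  assumes ficken: "\<And>(x :: 'a) y \<alpha> \<beta>. norm x = norm y \<Longrightarrow>
      norm (\<alpha> *\<^sub>R x + \<beta> *\<^sub>R y) = norm (\<beta> *\<^sub>R x + \<alpha> *\<^sub>R y)"
    and e: "norm e1 = 1" "norm e2 = 1" "norm (e1 + e2) = norm (e1 - e2)"
    and unit: "norm (p *\<^sub>R e1 + q *\<^sub>R e2) = 1"
  shows "p\<^sup>2 + q\<^sup>2 = 1"
proof -
  define N where "N = (\<lambda>p q. norm (p *\<^sub>R e1 + q *\<^sub>R e2))"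
  have swap: "N x y = N y x" for x y
    unfolding N_def using e by (intro ficken) simp
  \<comment> \<open>Ficken's condition for the pair \<open>e1 + e2\<close>, \<open>e1 - e2\<close>,
    whose exchange fixes \<open>e1\<close> and negates \<open>e2\<close>.\<close>
  have neg: "N x (- y) = N x y" for x y
  proof -
    have "norm (\<alpha> *\<^sub>R (e1 + e2) + \<beta> *\<^sub>R (e1 - e2)) = norm (\<beta> *\<^sub>R (e1 + e2) + \<alpha> *\<^sub>R (e1 - e2))" for \<alpha> \<beta>
      by (rule ficken) (rule e(3))
    moreover have "\<alpha> *\<^sub>R (e1 + e2) + \<beta> *\<^sub>R (e1 - e2) = (\<alpha> + \<beta>) *\<^sub>R e1 + (\<alpha> - \<beta>) *\<^sub>R e2" for \<alpha> \<beta>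
      by (simp add: algebra_simps)
    ultimately have "N (\<alpha> + \<beta>) (\<alpha> - \<beta>) = N (\<beta> + \<alpha>) (\<beta> - \<alpha>)" for \<alpha> \<beta>
      by (simp only: N_def)
    from this[of "(x + y) / 2" "(x - y) / 2"] show ?thesis
      by (simp add: field_simps)
  qed
  have coord: "\<bar>y\<bar> \<le> N x y" for x y
  proof -
    have "2 * \<bar>y\<bar> = norm ((2 * y) *\<^sub>R e2)"
      using e(2) by simp
    also have "(2 * y) *\<^sub>R e2 = (x *\<^sub>R e1 + y *\<^sub>R e2) + ((- x) *\<^sub>R e1 + y *\<^sub>R e2)"
      using scaleR_2[of "y *\<^sub>R e2"] by (simp add: algebra_simps)
    also have "norm \<dots> \<le> N x y + N (- x) y"
      unfolding N_def by (rule norm_triangle_ineq)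
    also have "N (- x) y = N x y"
      using swap[of "- x" y] neg[of y x] swap[of x y] by simp
    finally show ?thesis
      by simp
  qed
  have move: "N (\<beta> + \<alpha> * p) (\<alpha> * q) = N (\<alpha> + \<beta> * p) (\<beta> * q)" if "N p q = 1" for p q \<alpha> \<beta>
  proof -
    have "norm (\<alpha> *\<^sub>R e1 + \<beta> *\<^sub>R (p *\<^sub>R e1 + q *\<^sub>R e2)) = norm (\<beta> *\<^sub>R e1 + \<alpha> *\<^sub>R (p *\<^sub>R e1 + q *\<^sub>R e2))"
      using that e(1) by (intro ficken) (simp add: N_def)
    then show ?thesis
      by (simp add: N_def algebra_simps)
  qed
  have le1: "p\<^sup>2 + q\<^sup>2 \<le> 1" if 1: "N p q = 1" for p q
  proof (cases "q = 0")
    case True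
    then have "\<bar>p\<bar> = 1"
      using 1 e(1) by (simp add: N_def)
    with True show ?thesis
      by (simp add: abs_square_le_1)
  next
    case False
    \<comment> \<open>Chosen so that \<open>move\<close> with \<open>\<beta> = p / q\<close> equates
      \<open>N (- q) p = 1\<close> with the norm of a vector whose second coordinate is
      \<open>- (p\<^sup>2 + q\<^sup>2)\<close>.\<close>
    define \<alpha> where "\<alpha> = - q - p\<^sup>2 / q"
    have \<alpha>: "\<alpha> * q = - (p\<^sup>2 + q\<^sup>2)" "\<alpha> + (p / q) * p = - q" "(p / q) * q = p"
      using False by (simp_all add: \<alpha>_def field_simps power2_eq_square)
    have "p\<^sup>2 + q\<^sup>2 = \<bar>\<alpha> * q\<bar>"
      by (simp add: \<alpha>(1))
    also have "\<dots> \<le> N (p / q + \<alpha> * p) (\<alpha> * q)"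
      by (rule coord)
    also have "\<dots> = N (- q) p"
      by (simp only: move[OF 1, of "p / q" \<alpha>] \<alpha>(2,3))
    also have "\<dots> = 1"
      using swap[of "- q" p] neg[of p q] 1 by simp
    finally show ?thesis .
  qed
  have 1: "N p q = 1"
    using unit by (simp add: N_def)
  show ?thesis
  proof (cases "q = 0")
    case True
    then have "\<bar>p\<bar> = 1"
      using 1 e(1) by (simp add: N_def)
    with True show ?thesis
      by (simp add: abs_square_eq_1)
  next
    case False
    \<comment> \<open>\<open>k e1 - p e2\<close> is the image of \<open>e2 = (z - p e1) / q\<close>
      under the exchange of \<open>e1\<close> and \<open>z\<close>, hence a unit vector.\<close>
    define k where "k = (1 - p\<^sup>2) / q"
    have "1 / q + (- p / q) * p = k" "(- p / q) * q = - p" "- p / q + 1 / q * p = 0" "1 / q * q = 1"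
      using False by (simp_all add: k_def field_simps power2_eq_square)
    with move[OF 1, of "1 / q" "- p / q"] have "N k (- p) = N 0 1"
      by simp
    then have "k\<^sup>2 + (- p)\<^sup>2 \<le> 1"
      using e(2) by (intro le1) (simp add: N_def)
    moreover have "p\<^sup>2 + q\<^sup>2 \<le> 1"
      using 1 by (rule le1)
    moreover have kq: "p\<^sup>2 + k * q = 1"
      using False by (simp add: k_def)
    ultimately have "(k - q)\<^sup>2 \<le> 0"
      by (simp add: power2_diff)
    then have "k = q"
      by simp
    with kq show ?thesis
      by (simp add: power2_eq_square)
  qed
qed

text \<open>The form comes from polarization, so it is symmetric by construction; in coordinates it
  is the standard dot product.\<close>

lemma euclidean_norm_if_coordinates:
  fixes e1 e2 :: "'a::real_normed_vector"
  assumes span: "\<And>z. \<exists>p q. z = p *\<^sub>R e1 + q *\<^sub>R e2"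
    and norm: "\<And>p q. norm (p *\<^sub>R e1 + q *\<^sub>R e2) = sqrt (p\<^sup>2 + q\<^sup>2)"
  shows "euclidean_norm TYPE('a)"
proof -
  define B :: "'a \<Rightarrow> 'a \<Rightarrow> real" where "B x y = ((norm (x + y))\<^sup>2 - (norm (x - y))\<^sup>2) / 4" for x y
  have B: "B (p *\<^sub>R e1 + q *\<^sub>R e2) (r *\<^sub>R e1 + s *\<^sub>R e2) = p * r + q * s" for p q r s
  proof -
    have "(p *\<^sub>R e1 + q *\<^sub>R e2) + (r *\<^sub>R e1 + s *\<^sub>R e2) = (p + r) *\<^sub>R e1 + (q + s) *\<^sub>R e2"
      "(p *\<^sub>R e1 + q *\<^sub>R e2) - (r *\<^sub>R e1 + s *\<^sub>R e2) = (p - r) *\<^sub>R e1 + (q - s) *\<^sub>R e2"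
      by (simp_all add: algebra_simps)
    then show ?thesis
      by (simp only: B_def norm real_sqrt_pow2[OF sum_power2_ge_zero])
        (simp add: power2_eq_square algebra_simps)
  qed
  have sym: "B x y = B y x" for x y
    by (simp add: B_def add.commute norm_minus_commute)
  have add: "B x (y + z) = B x y + B x z" for x y z
  proof -
    obtain p q r s t u where xyz: "x = p *\<^sub>R e1 + q *\<^sub>R e2" "y = r *\<^sub>R e1 + s *\<^sub>R e2" "z = t *\<^sub>R e1 + u *\<^sub>R e2"
      using span by metis
    have sum: "y + z = (r + t) *\<^sub>R e1 + (s + u) *\<^sub>R e2"
      by (simp add: xyz algebra_simps)
    show ?thesis
      unfolding sum unfolding xyz B by (simp add: algebra_simps)
  qed
  have scale: "B x (c *\<^sub>R y) = c *\<^sub>R B x y" for x y c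
  proof -
    obtain p q r s where xy: "x = p *\<^sub>R e1 + q *\<^sub>R e2" "y = r *\<^sub>R e1 + s *\<^sub>R e2"
      using span by metis
    have prod: "c *\<^sub>R y = (c * r) *\<^sub>R e1 + (c * s) *\<^sub>R e2"
      by (simp add: xy algebra_simps)
    show ?thesis
      unfolding prod unfolding xy B by (simp add: algebra_simps)
  qed
  have norm_B: "norm x = sqrt (B x x)" for x
    by (simp add: B_def power_mult_distrib flip: scaleR_2)
  have pos: "B x x > 0" if "x \<noteq> 0" for x
    using that norm_B[of x] by (metis norm_le_zero_iff not_le real_sqrt_gt_0_iff)
  have "linear (B x)" for x
    by (rule linearI) (rule add, rule scale)
  moreover have "(\<lambda>x. B x y) = B y" for y
    using sym by auto
  ultimately have "bilinear B"
    by (simp add: bilinear_def)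
  then show ?thesis
    unfolding euclidean_norm_def inner_product_form_def using sym pos norm_B by blast
qed

text \<open>The sum and difference of two normalized basis vectors are isosceles orthogonal. They
  remain so after normalization to \<open>e1\<close>, \<open>e2\<close>, which supplies the basis
  for \<open>unit_circle_coordinates\<close>.\<close>

lemma euclidean_norm_if_isosceles_imp_birkhoff:
  assumes "minkowski_plane TYPE('a::real_normed_vector)"
    and IB: "\<And>u v :: 'a. isosceles_orthogonal u v \<Longrightarrow> birkhoff_orthogonal u v"
  shows "euclidean_norm TYPE('a)"
proof -
  have iso: "isosceles_orthogonal (c *\<^sub>R u) (d *\<^sub>R v)" if "isosceles_orthogonal u v" for u v :: 'a and c d
    using IB that by (rule isosceles_orthogonal_scale_both)
  have ficken: "norm (\<alpha> *\<^sub>R x + \<beta> *\<^sub>R y) = norm (\<beta> *\<^sub>R x + \<alpha> *\<^sub>R y)"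
    if "norm x = norm y" for x y :: 'a and \<alpha> \<beta>
    using iso that by (rule ficken_condition)
  obtain A :: "'a set" where A: "independent A" "span A = UNIV" "card A = 2"
    using basis_exists[of "UNIV :: 'a set"] assms(1) unfolding minkowski_plane_def
    by (metis UNIV_I subset_antisym top_greatest)
  then obtain f g where "A = {f, g}" "f \<noteq> g"
    by (auto simp: card_2_iff)
  with A(1) have "f \<noteq> 0" "g \<noteq> 0"
    using dependent_zero[of A] by auto
  define x where "x = f /\<^sub>R norm f"
  define y where "y = g /\<^sub>R norm g"
  have "norm x = norm y"
    using \<open>f \<noteq> 0\<close> \<open>g \<noteq> 0\<close> by (simp add: x_def y_def)
  have fg: "f = norm f *\<^sub>R x" "g = norm g *\<^sub>R y"
    using \<open>f \<noteq> 0\<close> \<open>g \<noteq> 0\<close> by (simp_all add: x_def y_def)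
  have ne: "f \<noteq> c *\<^sub>R g" for c
    using A(1) \<open>f \<noteq> g\<close> \<open>A = {f, g}\<close> by (auto simp: independent_insert span_singleton)
  have sum_diff: "x + y \<noteq> 0" "x - y \<noteq> 0"
  proof -
    show "x - y \<noteq> 0"
      using ne[of "norm f / norm g"] fg by (auto simp: y_def divide_inverse)
    show "x + y \<noteq> 0"
    proof
      assume "x + y = 0"
      then have "x = - y"
        by (simp add: eq_neg_iff_add_eq_0)
      then show False
        using ne[of "- (norm f / norm g)"] fg by (auto simp: y_def divide_inverse)
    qed
  qed
  define e1 where "e1 = (x + y) /\<^sub>R norm (x + y)"
  define e2 where "e2 = (x - y) /\<^sub>R norm (x - y)"
  have e: "norm e1 = 1" "norm e2 = 1"
    using sum_diff by (simp_all add: e1_def e2_def)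
  have "isosceles_orthogonal e1 e2"
    unfolding e1_def e2_def by (intro iso isosceles_orthogonal_sum_diff \<open>norm x = norm y\<close>)
  then have e12: "norm (e1 + e2) = norm (e1 - e2)"
    by (simp add: isosceles_orthogonal_def)
  have in_span: "z \<in> span {e1, e2}" for z
  proof -
    have "x + y = norm (x + y) *\<^sub>R e1" "x - y = norm (x - y) *\<^sub>R e2"
      using sum_diff by (simp_all add: e1_def e2_def)
    then have 1: "x + y \<in> span {e1, e2}" "x - y \<in> span {e1, e2}"
      by (metis insertI1 insertI2 span_base span_scale)+
    have "x = (1/2) *\<^sub>R ((x + y) + (x - y))" "y = (1/2) *\<^sub>R ((x + y) - (x - y))"
      by (simp_all add: flip: scaleR_2)
    then have "x \<in> span {e1, e2}" "y \<in> span {e1, e2}"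
      using 1 by (metis span_add span_diff span_scale)+
    then have "f \<in> span {e1, e2}" "g \<in> span {e1, e2}"
      using fg by (metis span_scale)+
    then have "span A \<subseteq> span {e1, e2}"
      using \<open>A = {f, g}\<close> by (intro span_minimal) auto
    with A(2) show ?thesis
      by auto
  qed
  have span: "\<exists>p q. z = p *\<^sub>R e1 + q *\<^sub>R e2" for z
    using in_span[of z] by (auto simp: span_breakdown_eq algebra_simps)
  have norm: "norm (p *\<^sub>R e1 + q *\<^sub>R e2) = sqrt (p\<^sup>2 + q\<^sup>2)" for p q
  proof (cases "p *\<^sub>R e1 + q *\<^sub>R e2 = 0")
    case False
    define n where "n = norm (p *\<^sub>R e1 + q *\<^sub>R e2)"
    have "n > 0"
      using False by (simp add: n_def)
    have "(p / n) *\<^sub>R e1 + (q / n) *\<^sub>R e2 = (p *\<^sub>R e1 + q *\<^sub>R e2) /\<^sub>R n"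
      by (simp add: algebra_simps divide_inverse)
    then have "norm ((p / n) *\<^sub>R e1 + (q / n) *\<^sub>R e2) = 1"
      using \<open>n > 0\<close> by (simp add: n_def)
    then have "(p / n)\<^sup>2 + (q / n)\<^sup>2 = 1"
      by (intro unit_circle_coordinates[OF ficken e e12])
    then have "p\<^sup>2 + q\<^sup>2 = n\<^sup>2"
      using \<open>n > 0\<close> by (simp add: power_divide flip: add_divide_distrib)
    then show ?thesis
      using \<open>n > 0\<close> by (simp add: n_def)
  next
    case True
    then have "norm (p *\<^sub>R e1) = norm (q *\<^sub>R e2)"
      by (metis add_eq_0_iff norm_minus_cancel)
    then have "\<bar>p\<bar> = \<bar>q\<bar>"
      using e by simp
    have "p = 0"
    proof (rule ccontr)
      assume "p \<noteq> 0"
      have "norm (p *\<^sub>R e1 - q *\<^sub>R e2) = 0"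
        using iso[OF \<open>isosceles_orthogonal e1 e2\<close>, of p q] True
        by (simp add: isosceles_orthogonal_def)
      with True have "p *\<^sub>R e1 + p *\<^sub>R e1 = 0"
        by (metis add.right_neutral eq_iff_diff_eq_0 norm_eq_zero)
      with \<open>p \<noteq> 0\<close> e(1) show False
        by (auto simp flip: scaleR_2)
    qed
    with True \<open>\<bar>p\<bar> = \<bar>q\<bar>\<close> show ?thesis
      by simp
  qed
  from span norm show ?thesis
    by (rule euclidean_norm_if_coordinates)
qed

section \<open>Orthocentric systems, in general and in the Euclidean case\<close>

lemma isosceles_orthogonal_step:
  fixes u v :: "'a::real_normed_vector"
  assumes C: "\<And>p1 p2 p3 p4 :: 'a. C_orthocentric_system {p1, p2, p3, p4} \<Longrightarrow>
      p3 \<noteq> midpoint p1 p2 \<Longrightarrow> p4 \<in> affine hull {p3, midpoint p1 p2} \<Longrightarrow>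
      norm (p3 - p1) = norm (p3 - p2)"
    and iso: "isosceles_orthogonal u v" and "u \<noteq> 0"
  shows "isosceles_orthogonal ((1 + norm (u + v) / norm u) *\<^sub>R u) v"
proof (cases "v = 0")
  case False
  define \<rho> where "\<rho> = norm (u + v) / norm u"
  have "\<rho> > 0"
    using isosceles_orthogonal_norm_le[OF iso] \<open>u \<noteq> 0\<close>
    by (metis \<rho>_def divide_pos_pos less_le_trans zero_less_norm_iff)
  define a where "a = u + v"
  define b where "b = u - v"
  \<comment> \<open>Of the two points of the circle on the line through \<open>0\<close> and
    \<open>u\<close>, this is the one beyond \<open>0\<close>: then \<open>c\<close> differs from
    the midpoint \<open>u\<close>, and \<open>u - c\<close> is the multiple of \<open>u\<close> by
    \<open>1 + \<rho>\<close>.\<close>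
  define c where "c = (- \<rho>) *\<^sub>R u"
  define d where "d = (2 - \<rho>) *\<^sub>R u"
  have np: "v \<noteq> k *\<^sub>R u" for k
    by (rule isosceles_orthogonal_not_parallel[OF iso \<open>u \<noteq> 0\<close> False])
  have off: "u + v \<noteq> k *\<^sub>R u" "u - v \<noteq> k *\<^sub>R u" for k
    using np[of "k - 1"] np[of "1 - k"] by (auto simp: algebra_simps)
  have "a \<noteq> b"
    using False by (auto simp: a_def b_def eq_neg_iff_add_eq_0 simp flip: scaleR_2)
  moreover have "d - c = 2 *\<^sub>R u"
    by (simp add: c_def d_def algebra_simps)
  then have "c \<noteq> d"
    using \<open>u \<noteq> 0\<close> by auto
  ultimately have "card {a, b, c, d} = 4"
    using off[of "- \<rho>"] off[of "2 - \<rho>"] by (auto simp: a_def b_def c_def d_def)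
  moreover have "0 \<in> circumcenters a b c"
    using iso \<open>u \<noteq> 0\<close>
    by (simp add: circumcenters_def a_def b_def c_def \<rho>_def isosceles_orthogonal_def norm_minus_commute add.commute)
  moreover have "d = C_orthocenter a b c 0"
    by (simp add: C_orthocenter_eq a_def b_def c_def d_def algebra_simps scaleR_2)
  ultimately have "C_orthocentric_system {a, b, c, d}"
    unfolding C_orthocentric_system_def by blast
  moreover have mid: "midpoint a b = u"
    by (simp add: midpoint_def a_def b_def flip: scaleR_2)
  moreover have "c \<noteq> u"
  proof -
    have "u - c = (1 + \<rho>) *\<^sub>R u"
      by (simp add: c_def algebra_simps)
    then show ?thesis
      using \<open>u \<noteq> 0\<close> \<open>\<rho> > 0\<close> by auto
  qed
  moreover have "d \<in> affine hull {c, u}"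
  proof -
    \<comment> \<open>Solves \<open>- \<rho> + t * (1 + \<rho>) = 2 - \<rho>\<close>, comparing the
      multiples of \<open>u\<close> in \<open>c\<close>, \<open>u\<close> and
      \<open>d\<close>.\<close>
    define t where "t = 2 / (1 + \<rho>)"
    have "1 + \<rho> \<noteq> 0"
      using \<open>\<rho> > 0\<close> by linarith
    then have "t * (1 + \<rho>) = 2"
      using t_def by (rule nonzero_eq_divide_eq[THEN iffD1])
    then have "(1 - t) * (- \<rho>) + t = 2 - \<rho>"
      by (simp add: algebra_simps)
    then have "d = ((1 - t) * (- \<rho>) + t) *\<^sub>R u"
      by (simp only: d_def)
    then have "d = (1 - t) *\<^sub>R c + t *\<^sub>R u"
      by (simp only: c_def scaleR_scaleR scaleR_add_left)
    then show ?thesis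
      unfolding affine_hull_2 by (intro CollectI exI[of _ "1 - t"] exI[of _ t]) simp
  qed
  ultimately have "norm (c - a) = norm (c - b)"
    using C[of a b c d] by simp
  moreover have "c - a = - ((1 + \<rho>) *\<^sub>R u + v)" "c - b = - ((1 + \<rho>) *\<^sub>R u - v)"
    by (simp_all add: a_def b_def c_def algebra_simps)
  ultimately show ?thesis
    unfolding isosceles_orthogonal_def \<rho>_def by (metis norm_minus_cancel)
qed simp

text \<open>With \<open>c - d = 2 x - a - b\<close>, the product of \<open>a - b\<close> and
  \<open>c - d\<close> is the difference of the squared distances of \<open>x\<close> to
  \<open>b\<close> and \<open>a\<close>, which is zero. The other pairs of opposite edges are alike,
  so the labeling is irrelevant.\<close>

lemma C_orthocentric_system_orthogonal:
  fixes B :: "'a::real_normed_vector \<Rightarrow> 'a \<Rightarrow> real"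
  assumes B: "inner_product_form B" "\<And>x. norm x = sqrt (B x x)"
    and P: "C_orthocentric_system P" "P = {p1, p2, p3, p4}"
  shows "B (p1 - p2) (p3 - p4) = 0"
proof -
  have bil: "bilinear B" and sym: "B x y = B y x" for x y
    using B(1) by (auto simp: inner_product_form_def)
  note simps = bilinear_ladd[OF bil] bilinear_radd[OF bil] bilinear_lsub[OF bil] bilinear_rsub[OF bil]
    bilinear_lmul[OF bil] bilinear_rmul[OF bil]
  obtain a b c d x where abcd: "P = {a, b, c, d}" "card P = 4"
    and x: "x \<in> circumcenters a b c" "d = C_orthocenter a b c x"
    using P(1) unfolding C_orthocentric_system_def by blast
  have d: "d = a + b + c - 2 *\<^sub>R x"
    using x(2) by (simp add: C_orthocenter_eq)
  have "B (x - a) (x - a) = B (x - b) (x - b)" "B (x - b) (x - b) = B (x - c) (x - c)"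
    using x(1) B(2) by (simp_all add: circumcenters_def)
  then have orth: "B (a - b) (c - d) = 0" "B (a - c) (b - d) = 0" "B (b - c) (a - d) = 0"
    unfolding d by (simp_all add: simps sym[of a x] sym[of b x] sym[of c x] sym[of b a] sym[of c a] sym[of c b] algebra_simps)
  have flip: "B (v - u) (w - z) = 0" "B (u - v) (z - w) = 0" "B (v - u) (z - w) = 0"
    "B (w - z) (u - v) = 0" "B (w - z) (v - u) = 0" "B (z - w) (u - v) = 0" "B (z - w) (v - u) = 0"
    if "B (u - v) (w - z) = 0" for u v w z
  proof -
    have *: "B (y - x) t = - B (x - y) t" "B t (y - x) = - B t (x - y)" for x y t
      by (simp_all add: simps)
    show "B (v - u) (w - z) = 0" "B (u - v) (z - w) = 0" "B (v - u) (z - w) = 0"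
      "B (w - z) (u - v) = 0" "B (w - z) (v - u) = 0" "B (z - w) (u - v) = 0" "B (z - w) (v - u) = 0"
      using that sym[of "w - z" "u - v"]
      by (simp_all add: *(1)[of v u] *(2)[of _ z w] *(1)[of z w] *(2)[of _ v u])
  qed
  have "distinct [p1, p2, p3, p4]"
    using abcd(2) P(2) by (intro card_distinct) simp
  moreover have "distinct [a, b, c, d]"
    using abcd by (intro card_distinct) simp
  moreover have "p1 \<in> {a, b, c, d}" "p2 \<in> {a, b, c, d}" "p3 \<in> {a, b, c, d}" "p4 \<in> {a, b, c, d}"
    using abcd(1) P(2) by auto
  ultimately show ?thesis
    \<comment> \<open>Distinctness leaves only the permutations among all assignments of
      \<open>p1\<close>, ..., \<open>p4\<close> to \<open>a\<close>, \<open>b\<close>,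
      \<open>c\<close>, \<open>d\<close>; each is one of \<open>orth\<close> up to signs and
      order.\<close>
    by (elim insertE emptyE) (simp_all add: orth flip[OF orth(1)] flip[OF orth(2)] flip[OF orth(3)])
qed

theorem theorem3p8:
  assumes "minkowski_plane TYPE('a::real_normed_vector)"
  shows "euclidean_norm TYPE('a) \<longleftrightarrow>
    (\<forall>p1 p2 p3 p4 :: 'a.
      C_orthocentric_system {p1, p2, p3, p4} \<longrightarrow>
      p3 \<noteq> midpoint p1 p2 \<longrightarrow>
      p4 \<in> affine hull {p3, midpoint p1 p2} \<longrightarrow>
      norm (p3 - p1) = norm (p3 - p2))"
  (is "_ \<longleftrightarrow> ?C")
proof
  assume ?C
  then have C: "norm (p3 - p1) = norm (p3 - p2)"
    if "C_orthocentric_system {p1, p2, p3, p4}" "p3 \<noteq> midpoint p1 p2"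
      "p4 \<in> affine hull {p3, midpoint p1 p2}" for p1 p2 p3 p4 :: 'a
    using that by blast
  show "euclidean_norm TYPE('a)"
    using assms
    by (rule euclidean_norm_if_isosceles_imp_birkhoff)
      (rule isosceles_imp_birkhoff_orthogonal[OF isosceles_orthogonal_step[OF C]])
next
  assume "euclidean_norm TYPE('a)"
  then obtain B :: "'a \<Rightarrow> 'a \<Rightarrow> real"
    where B: "inner_product_form B" "\<And>x. norm x = sqrt (B x x)"
    by (auto simp: euclidean_norm_def)
  have bil: "bilinear B" and sym: "B x y = B y x" for x y
    using B(1) by (auto simp: inner_product_form_def)
  show ?C
  proof (intro allI impI)
    fix p1 p2 p3 p4 :: 'a
    define m where "m = midpoint p1 p2"
    assume P: "C_orthocentric_system {p1, p2, p3, p4}" and "p4 \<in> affine hull {p3, midpoint p1 p2}"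
    then obtain r t where "p4 = r *\<^sub>R p3 + t *\<^sub>R m" "r + t = 1"
      by (auto simp: affine_hull_2 m_def)
    moreover from this(2) have "r = 1 - t"
      by simp
    ultimately have "p3 - p4 = t *\<^sub>R (p3 - m)"
      by (simp add: algebra_simps)
    \<comment> \<open>This makes \<open>t\<close> nonzero, so orthogonality passes from
      \<open>p3 - p4\<close> to \<open>p3 - m\<close>, and \<open>p3\<close> lies on the
      perpendicular bisector of \<open>p1\<close> and \<open>p2\<close>.\<close>
    moreover have "p3 \<noteq> p4"
    proof
      assume "p3 = p4"
      then have "card {p1, p2, p3, p4} \<le> card (set [p1, p2, p3])"
        by (intro card_mono) auto
      also have "\<dots> \<le> 3"
        using card_length[of "[p1, p2, p3]"] by simp
      finally show False
        using P by (simp add: C_orthocentric_system_def)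
    qed
    moreover have "B (p1 - p2) (p3 - p4) = 0"
      using C_orthocentric_system_orthogonal[OF B P] by simp
    ultimately have "B (p1 - p2) (p3 - m) = 0"
      by (auto simp: bilinear_rmul[OF bil])
    then have "B (p3 - p1) (p3 - p1) = B (p3 - p2) (p3 - p2)"
      by (simp add: m_def midpoint_def bilinear_ladd[OF bil] bilinear_radd[OF bil] bilinear_lsub[OF bil]
          bilinear_rsub[OF bil] bilinear_rmul[OF bil] sym[of p3 p1] sym[of p3 p2] sym[of p2 p1] algebra_simps)
    then show "norm (p3 - p1) = norm (p3 - p2)"
      by (simp add: B(2))
  qed
qed

end
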